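(* Let $\{z_k\}=\{(x_k,y_k)\}$ be a sequence generated by the FWdc algorithm, let $\bar y\in D_s(\mathcal{G})$, let $C\neq V$ be a (nonempty) clique in $\mathcal{G}(\bar y)$, and let $\delta_{\max}$ be the maximum eigenvalue of the adjacency matrix $\bar A:=A_{\mathcal{G}}+A(\bar y)$. Let $\bar k\in\mathbb{N}_0$ be a fixed index, let $I^c$ be the set of elements of $\mathrm{supp}(x_{\bar k})$ not in $C$, and let $L:=2\delta_{\max}+\alpha$. Assume that $y_{\bar k+j}=\bar y$ for $0\le j\le|I^c|$, that the stepsizes of the FDFW steps on the $x$ variable satisfy $$\alpha_k\ge\min\Big(\alpha_k^{\max},\,\frac1L\,\frac{\nabla_xh_{\mathcal{G}}(x_k,y_k)^{\intercal}d_k}{\|d_k\|^2}\Big),$$ and that $$\|x_{\bar k}-x^{(C)}\|_1\le\frac{m_\alpha(C,\mathcal{G}(\bar y))}{m_\alpha(C,\mathcal{G}(\bar y))+2|C|\delta_{\max}+|C|\alpha},$$ where $m_\alpha(C,\mathcal{G}(\bar y))=m(C,\mathcal{G}(\bar y))-1+\alpha/2$. Then $\mathrm{supp}(x_{\bar k+|I^c|})=C$.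
   Context: $\mathcal{G}=(V,E)$ is a finite simple undirected graph, $n=|V|$, $V$ identified with $\{1,\dots,n\}$, $A_{\mathcal{G}}$ its adjacency matrix, $\bar{\mathcal{G}}=(V,\bar E)$ the complementary graph; $e$ is the all-ones vector; $s\in\mathbb{N}$, $s\le|\bar E|$. $D_s(\mathcal{G})=\{y\in\{0,1\}^{\bar E}:e^{\intercal}y\le s\}$, $D'_s(\mathcal{G})=\{y\in[0,1]^{\bar E}:e^{\intercal}y\le s\}$. For $y\in D'_s(\mathcal{G})$, $A(y)\in\mathbb{R}^{n\times n}$ is the symmetric matrix with $A(y)_{ij}=y_{ij}$ if $\{i,j\}\in\bar E$ and $0$ otherwise; for $y\in D_s(\mathcal{G})$, $\mathcal{G}(y)$ is the graph with adjacency matrix $A_{\mathcal{G}}+A(y)$ and $E^y(v)$ is the set of neighbors of $v$ in $\mathcal{G}(y)$. For a clique $C\ne V$ of $\mathcal{G}(y)$, $m(C,\mathcal{G}(y))=\min_{v\in V\setminus C}\big(|C|-|E^y(v)\cap C|\big)$. $\mathcal{P}_s=\Delta_{n-1}\times D'_s(\mathcal{G})$ with $\Delta_{n-1}$ the standard simplex in $\mathbb{R}^n$. For fixed $\alpha\in(0,2)$, $\beta>0$, $h_{\mathcal{G}}(x,y)=x^{\intercal}[A_{\mathcal{G}}+A(y)]x+\tfrac{\alpha}{2}\|x\|^2+\tfrac{\beta}{2}\|y\|^2$. For nonempty $C\subseteq V$, $x^{(C)}=\frac1{|C|}\sum_{i\in C}e_i$. FDFW step for maximizing a continuously differentiable $f$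 over a polytope $\mathcal{Q}$, from $w\in\mathcal{Q}$: if $w$ is stationary ($\nabla f(w)^{\intercal}(v-w)\le0$ for all $v\in\mathcal{Q}$) the point is left unchanged. Otherwise choose $s^*\in\arg\max_{u\in\mathcal{Q}}\nabla f(w)^{\intercal}u$, $d^{\mathcal{FW}}=s^*-w$, and $v^*\in\arg\min_{u\in\mathcal{F}(w)}\nabla f(w)^{\intercal}u$, $d^{\mathcal{FD}}=w-v^*$, where $\mathcal{F}(w)$ is the minimal face of $\mathcal{Q}$ containing $w$; let $d=d^{\mathcal{FW}}$ if $\nabla f(w)^{\intercal}d^{\mathcal{FW}}\ge\nabla f(w)^{\intercal}d^{\mathcal{FD}}$ and $d=d^{\mathcal{FD}}$ otherwise; move to $w+ad$ with a stepsize $a\in(0,a^{\max}]$, $a^{\max}=\max\{t\ge0:w+td\in\mathcal{Q}\}$. FWdc algorithm: start from $z_0=(x_0,y_0)\in\mathcal{P}_s$. At iteration $k$: stop if $z_k$ is stationary for $h_{\mathcal{G}}$ on $\mathcal{P}_s$ (the sequence is then continued as constant); otherwise $x_{k+1}$ is obtained by one FDFW step from $x_k$ for $f(w)=h_{\mathcal{G}}(w,y_k)$ over $\mathcal{Q}=\Delta_{n-1}$ (with direction $d_k$, stepsize $\alpha_k$, maximal stepsize $\alpha_k^{\max}$), and $y_{k+1}\in\arg\max_{y\in D'_s(\mathcal{G})}\nabla_yh_{\mathcal{G}}(x_k,y_k)^{\intercal}y$, the iterates $y_k$ always being chosen in the set $D_s(\mathcal{G})$ of vertices of $D'_s(\mathcal{G})$.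 Stepsize conditions are required only at iterations where an actual step is taken.
   Formalization: The minimizer v* over the minimal face in the FDFW step is required to be a vertex of that face; with an arbitrary minimizer in case of ties, one step can remove several indices and a later step can leave C, so the claim fails. *)

theory Defs
  imports "HOL-Analysis.Analysis" "HOL-Library.Ramsey"
begin

text \<open>Graphs have the whole finite type \<open>'n\<close> as vertex set and are given by their edge set, a set
  of two-element subsets of \<open>'n\<close>. Cliques are those of \<open>HOL-Library.Ramsey\<close>:
  \<open>clique C F\<close> says that any two distinct elements of \<open>C\<close> form an edge in \<open>F\<close>.\<close>

definition simple_graph :: "'n::finite set set \<Rightarrow> bool" where
  "simple_graph E \<longleftrightarrow> (\<forall>e\<in>E. card e = 2)"

definition compl_edges :: "'n::finite set set \<Rightarrow> 'n set set" where
  "compl_edges E = {e. card e = 2 \<and> e \<notin> E}"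

definition adj_matrix :: "'n::finite set set \<Rightarrow> real^'n^'n" where
  "adj_matrix E = (\<chi> i j. if {i, j} \<in> E then 1 else 0)"

text \<open>The index set of \<open>y\<close> depends on the graph, so the space of real vectors indexed by the
  edges of the complement is represented as the coordinate subspace of \<open>real^('n set)\<close> of vectors
  vanishing outside \<open>compl_edges E\<close>; on it, inner product and norm are the usual ones.\<close>

definition D_set :: "'n::finite set set \<Rightarrow> nat \<Rightarrow> (real^('n set)) set" where
  "D_set E s = {y. (\<forall>e\<in>compl_edges E. y $ e \<in> {0, 1}) \<and> (\<forall>e. e \<notin> compl_edges E \<longrightarrow> y $ e = 0)
                   \<and> (\<Sum>e\<in>compl_edges E. y $ e) \<le> real s}"

definition D'_set :: "'n::finite set set \<Rightarrow> nat \<Rightarrow> (real^('n set)) set" where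
  "D'_set E s = {y. (\<forall>e\<in>compl_edges E. y $ e \<in> {0..1}) \<and> (\<forall>e. e \<notin> compl_edges E \<longrightarrow> y $ e = 0)
                    \<and> (\<Sum>e\<in>compl_edges E. y $ e) \<le> real s}"

definition A_mat :: "'n::finite set set \<Rightarrow> real^('n set) \<Rightarrow> real^'n^'n" where
  "A_mat E y = (\<chi> i j. if {i, j} \<in> compl_edges E then y $ {i, j} else 0)"

text \<open>Edge set of the graph with adjacency matrix \<open>adj_matrix E + A_mat E y\<close>,
  meant for \<open>y \<in> D_set E s\<close>.\<close>

definition aug_edges :: "'n::finite set set \<Rightarrow> real^('n set) \<Rightarrow> 'n set set" where
  "aug_edges E y = {{i, j} |i j. (adj_matrix E + A_mat E y) $ i $ j = 1}"

definition neighbors :: "'n::finite set set \<Rightarrow> 'n \<Rightarrow> 'n set" where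
  "neighbors F v = {u. {v, u} \<in> F}"

definition m_clique :: "'n::finite set \<Rightarrow> 'n set set \<Rightarrow> real" where
  "m_clique C F = Min ((\<lambda>v. real (card C) - real (card (neighbors F v \<inter> C))) ` (UNIV - C))"

definition m_clique_alpha :: "real \<Rightarrow> 'n::finite set \<Rightarrow> 'n set set \<Rightarrow> real" where
  "m_clique_alpha \<alpha> C F = m_clique C F - 1 + \<alpha> / 2"

definition eigenvalue :: "real^'n^'n \<Rightarrow> real \<Rightarrow> bool" where
  "eigenvalue A l \<longleftrightarrow> (\<exists>v. v \<noteq> 0 \<and> A *v v = l *\<^sub>R v)"

definition max_eigenvalue :: "real^'n^'n \<Rightarrow> real" where
  "max_eigenvalue A = (GREATEST l. eigenvalue A l)"

definition std_simplex :: "(real^'n) set" where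
  "std_simplex = {x. (\<forall>i. 0 \<le> x $ i) \<and> (\<Sum>i\<in>UNIV. x $ i) = 1}"

definition P_set :: "'n::finite set set \<Rightarrow> nat \<Rightarrow> ((real^'n) \<times> (real^('n set))) set" where
  "P_set E s = std_simplex \<times> D'_set E s"

definition h_obj ::
  "'n::finite set set \<Rightarrow> real \<Rightarrow> real \<Rightarrow> (real^'n) \<times> (real^('n set)) \<Rightarrow> real" where
  "h_obj E \<alpha> \<beta> = (\<lambda>(x, y). x \<bullet> ((adj_matrix E + A_mat E y) *v x)
                         + \<alpha> / 2 * (norm x)\<^sup>2 + \<beta> / 2 * (norm y)\<^sup>2)"

definition clique_center :: "'n::finite set \<Rightarrow> real^'n" where
  "clique_center C = (1 / real (card C)) *\<^sub>R (\<Sum>i\<in>C. axis i 1)"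

definition supp :: "real^'n \<Rightarrow> 'n set" where
  "supp x = {i. x $ i \<noteq> 0}"

definition l1_norm :: "real^'n \<Rightarrow> real" where
  "l1_norm x = (\<Sum>i\<in>UNIV. \<bar>x $ i\<bar>)"

definition gradient :: "('a::real_inner \<Rightarrow> real) \<Rightarrow> 'a \<Rightarrow> 'a" where
  "gradient f w = (THE g. GDERIV f w :> g)"

definition stationary :: "('a::real_inner \<Rightarrow> real) \<Rightarrow> 'a set \<Rightarrow> 'a \<Rightarrow> bool" where
  "stationary f Q w \<longleftrightarrow> (\<forall>v\<in>Q. gradient f w \<bullet> (v - w) \<le> 0)"

definition minimal_face :: "'a::real_vector set \<Rightarrow> 'a \<Rightarrow> 'a set" where
  "minimal_face Q w = \<Inter>{F. F face_of Q \<and> w \<in> F}"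

definition max_step :: "'a::real_vector set \<Rightarrow> 'a \<Rightarrow> 'a \<Rightarrow> real" where
  "max_step Q w d = (GREATEST t. 0 \<le> t \<and> w + t *\<^sub>R d \<in> Q)"

text \<open>The linear minimization over the minimal face returns a vertex of that face. This matters
  when the minimizer is not unique: a step away from a non-vertex minimizer may remove several
  vertices from the support at once. The maximizer \<open>s\<close> over \<open>Q\<close> may be any one.\<close>

definition fdfw_direction :: "('a::real_inner \<Rightarrow> real) \<Rightarrow> 'a set \<Rightarrow> 'a \<Rightarrow> 'a \<Rightarrow> bool" where
  "fdfw_direction f Q w d \<longleftrightarrow>
     (\<exists>s v. is_arg_max (\<lambda>u. gradient f w \<bullet> u) (\<lambda>u. u \<in> Q) s \<and>
            is_arg_min (\<lambda>u. gradient f w \<bullet> u) (\<lambda>u. u \<in> minimal_face Q w) v \<and>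
            v extreme_point_of (minimal_face Q w) \<and>
            d = (if gradient f w \<bullet> (s - w) \<ge> gradient f w \<bullet> (w - v) then s - w else w - v))"

text \<open>One step from \<open>w\<close> to \<open>w'\<close> with direction \<open>d\<close> and stepsize \<open>a\<close>; the latter two are
  unconstrained if \<open>w\<close> is stationary.\<close>

definition fdfw_step ::
  "('a::real_inner \<Rightarrow> real) \<Rightarrow> 'a set \<Rightarrow> 'a \<Rightarrow> 'a \<Rightarrow> real \<Rightarrow> 'a \<Rightarrow> bool" where
  "fdfw_step f Q w d a w' \<longleftrightarrow>
     (if stationary f Q w then w' = w
      else fdfw_direction f Q w d \<and> 0 < a \<and> a \<le> max_step Q w d \<and> w' = w + a *\<^sub>R d)"

definition fwdc_sequence ::
  "'n::finite set set \<Rightarrow> nat \<Rightarrow> real \<Rightarrow> real \<Rightarrow> (nat \<Rightarrow> real^'n) \<Rightarrow> (nat \<Rightarrow> real^('n set)) \<Rightarrow>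
   (nat \<Rightarrow> real^'n) \<Rightarrow> (nat \<Rightarrow> real) \<Rightarrow> bool" where
  "fwdc_sequence E s \<alpha> \<beta> x y d a \<longleftrightarrow>
     (x 0, y 0) \<in> P_set E s \<and>
     (\<forall>k. if stationary (h_obj E \<alpha> \<beta>) (P_set E s) (x k, y k)
          then x (Suc k) = x k \<and> y (Suc k) = y k
          else fdfw_step (\<lambda>w. h_obj E \<alpha> \<beta> (w, y k)) std_simplex (x k) (d k) (a k) (x (Suc k)) \<and>
               is_arg_max (\<lambda>u. gradient (\<lambda>v. h_obj E \<alpha> \<beta> (x k, v)) (y k) \<bullet> u)
                 (\<lambda>u. u \<in> D'_set E s) (y (Suc k)) \<and>
               y (Suc k) \<in> D_set E s)"

definition x_step_taken ::
  "'n::finite set set \<Rightarrow> nat \<Rightarrow> real \<Rightarrow> real \<Rightarrow> real^'n \<Rightarrow> real^('n set) \<Rightarrow> bool" where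
  "x_step_taken E s \<alpha> \<beta> x y \<longleftrightarrow>
     \<not> stationary (h_obj E \<alpha> \<beta>) (P_set E s) (x, y) \<and>
     \<not> stationary (\<lambda>w. h_obj E \<alpha> \<beta> (w, y)) std_simplex x"

end

theory Submission
  imports Defs
begin

text \<open>Write \<open>c\<close> for the centre of \<open>C\<close>, \<open>\<epsilon>\<close> for the \<open>\<ell>\<^sub>1\<close> distance of the iterate to \<open>c\<close> and
  \<open>\<Delta> = 2 m\<^sub>\<alpha> / |C|\<close>. At \<open>c\<close> the partial gradient in \<open>x\<close> is constant on \<open>C\<close> and smaller by at least
  \<open>\<Delta>\<close> outside, and it changes by at most \<open>L \<epsilon> / 2\<close> per coordinate between \<open>c\<close> and the iterate. The
  closeness assumption amounts to \<open>2 L \<epsilon> \<le> \<Delta> (1 - \<epsilon>)\<close>. While the support is not contained in \<open>C\<close>,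
  this forces the in-face direction away from a vertex outside \<open>C\<close> to beat the Frank-Wolfe direction,
  and the lower bound on the stepsize to exceed the maximal step, so that this vertex leaves the
  support. Such a step does not increase \<open>\<epsilon>\<close>, and \<open>\<epsilon> < 2 / |C|\<close> keeps \<open>C\<close> in the support.\<close>

subsection \<open>Gradients, the largest eigenvalue and maximal steps\<close>

text \<open>Uniqueness of the derivative, tested on the vector \<open>g' - g\<close>, gives the
  definite description in \<open>gradient\<close> its meaning.\<close>

lemma gradient_eq: "GDERIV f w :> g \<Longrightarrow> gradient f w = g"
proof -
  assume g: "GDERIV f w :> g"
  have "g' = g" if g': "GDERIV f w :> g'" for g'
  proof -
    have "(\<lambda>h. h \<bullet> g') = (\<lambda>h. h \<bullet> g)"
      using g g' has_derivative_unique unfolding gderiv_def by blast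
    then have "(g' - g) \<bullet> g' = (g' - g) \<bullet> g" by metis
    then show "g' = g"
      by (metis eq_iff_diff_eq_0 inner_diff_right inner_eq_zero_iff)
  qed
  with g show ?thesis
    unfolding gradient_def by blast
qed

text \<open>Riesz representation in coordinates: the vector with coefficients \<open>D b\<close> on
  the basis represents the derivative \<open>D\<close>. So \<open>gradient\<close> can be used
  without an explicit formula.\<close>

lemma GDERIV_gradient:
  fixes f :: "'a::euclidean_space \<Rightarrow> real"
  assumes "f differentiable (at w)"
  shows "GDERIV f w :> gradient f w"
proof -
  obtain D where D: "(f has_derivative D) (at w)"
    using assms by (auto simp: differentiable_def)
  then interpret bounded_linear D by (rule has_derivative_bounded_linear)
  have "D = (\<lambda>h. h \<bullet> (\<Sum>b\<in>Basis. D b *\<^sub>R b))"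
  proof
    fix h
    have "D h = D (\<Sum>b\<in>Basis. (h \<bullet> b) *\<^sub>R b)"
      by (simp add: euclidean_representation)
    also have "\<dots> = h \<bullet> (\<Sum>b\<in>Basis. D b *\<^sub>R b)"
      by (simp add: sum scale inner_sum_right mult.commute)
    finally show "D h = h \<bullet> (\<Sum>b\<in>Basis. D b *\<^sub>R b)" .
  qed
  with D have "GDERIV f w :> (\<Sum>b\<in>Basis. D b *\<^sub>R b)"
    by (simp add: gderiv_def)
  then show ?thesis using gradient_eq by metis
qed

text \<open>Composing \<open>F\<close> with the embedding of \<open>w\<close> as
  \<open>(w, y)\<close> reads off the first component of the joint gradient.\<close>

lemma gradient_partial_inner:
  fixes F :: "'a::euclidean_space \<times> 'b::euclidean_space \<Rightarrow> real"
  assumes "F differentiable (at (x, y))"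
  shows "gradient F (x, y) \<bullet> (u, 0) = gradient (\<lambda>w. F (w, y)) x \<bullet> u"
proof -
  let ?G = "gradient F (x, y)"
  have "(F has_derivative (\<lambda>h. h \<bullet> ?G)) (at (x, y))"
    using GDERIV_gradient[OF assms] by (simp add: gderiv_def)
  then have "((\<lambda>w. F (w, y)) has_derivative (\<lambda>h. (h, 0) \<bullet> ?G)) (at x)"
    by (rule has_derivative_compose[rotated, where f = "\<lambda>w. (w, y)", simplified o_def])
      (auto intro!: derivative_eq_intros)
  then have "GDERIV (\<lambda>w. F (w, y)) x :> fst ?G"
    by (simp add: gderiv_def inner_prod_def)
  then show ?thesis
    by (simp add: gradient_eq inner_prod_def)
qed

text \<open>In coordinates the objective is a polynomial in both variables. Joint differentiability
  links the stopping test on \<open>P_set\<close> to the stationarity test in \<open>x\<close>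
  alone.\<close>

lemma h_obj_differentiable: "h_obj E \<alpha> \<beta> differentiable (at (z :: (real^'n::finite) \<times> (real^('n set))))"
proof -
  have A: "(\<lambda>z :: (real^'n) \<times> (real^('n set)). (adj_matrix E + A_mat E (snd z)) $ i $ j) differentiable (at z)"
    for i j
  proof (cases "{i, j} \<in> compl_edges E")
    case True
    then show ?thesis
      by (simp add: A_mat_def)
        (intro differentiable_add differentiable_const bounded_linear_imp_differentiable
          bounded_linear_compose[OF bounded_linear_vec_nth bounded_linear_snd])
  next
    case False
    then show ?thesis by (simp add: A_mat_def)
  qed
  have fs: "(\<lambda>z :: (real^'n) \<times> (real^('n set)). fst z $ i) differentiable (at z)" for i
    by (intro bounded_linear_imp_differentiable bounded_linear_compose[OF bounded_linear_vec_nth bounded_linear_fst])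
  have sn: "(\<lambda>z :: (real^'n) \<times> (real^('n set)). snd z $ i) differentiable (at z)" for i
    by (intro bounded_linear_imp_differentiable bounded_linear_compose[OF bounded_linear_vec_nth bounded_linear_snd])
  have "h_obj E \<alpha> \<beta> = (\<lambda>z. (\<Sum>i\<in>UNIV. \<Sum>j\<in>UNIV.
      fst z $ i * ((adj_matrix E + A_mat E (snd z)) $ i $ j * fst z $ j))
      + \<alpha> / 2 * (\<Sum>i\<in>UNIV. fst z $ i * fst z $ i) + \<beta> / 2 * (\<Sum>i\<in>UNIV. snd z $ i * snd z $ i))"
    unfolding h_obj_def
    by (rule ext) (simp add: case_prod_unfold power2_norm_eq_inner inner_vec_def
      matrix_vector_mult_def sum_distrib_left)
  moreover have "\<dots> differentiable (at z)"
    by (intro differentiable_add differentiable_sum differentiable_mult differentiable_const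
        A fs sn finite ballI)
  ultimately show ?thesis by simp
qed

text \<open>The increments \<open>(v - x, 0)\<close> are admissible because \<open>y\<close> stays
  in \<open>R\<close>. Used in contrapositive form: an iterate that is not stationary in
  \<open>x\<close> alone has not triggered the stopping rule.\<close>

lemma stationary_partial:
  fixes F :: "'a::euclidean_space \<times> 'b::euclidean_space \<Rightarrow> real"
  assumes "F differentiable (at (x, y))" "stationary F (Q \<times> R) (x, y)" "y \<in> R"
  shows "stationary (\<lambda>w. F (w, y)) Q x"
  using assms gradient_partial_inner[OF assms(1)] unfolding stationary_def by fastforce

text \<open>The constant \<open>c\<close> stands for the term in \<open>y\<close>, which is fixed
  during a step in \<open>x\<close>; symmetry of \<open>M\<close> merges the two bilinear terms of
  the derivative.\<close>

lemma gradient_quadratic: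
  fixes M :: "real^'n^'n"
  assumes "transpose M = M"
  shows "gradient (\<lambda>w. w \<bullet> (M *v w) + \<alpha> / 2 * (norm w)\<^sup>2 + c) x = 2 *\<^sub>R (M *v x) + \<alpha> *\<^sub>R x"
proof (rule gradient_eq)
  have sym: "a \<bullet> (M *v b) = b \<bullet> (M *v a)" for a b
    by (metis assms dot_lmul_matrix inner_commute transpose_matrix_vector)
  have "((\<lambda>w. w \<bullet> (M *v w) + \<alpha> / 2 * (w \<bullet> w) + c) has_derivative
      (\<lambda>h. x \<bullet> (M *v h) + h \<bullet> (M *v x) + \<alpha> / 2 * (x \<bullet> h + h \<bullet> x))) (at x)"
    by (auto intro!: derivative_eq_intros
      bounded_linear.has_derivative[OF matrix_vector_mul_bounded_linear])
  moreover have "x \<bullet> (M *v h) + h \<bullet> (M *v x) + \<alpha> / 2 * (x \<bullet> h + h \<bullet> x)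
      = h \<bullet> (2 *\<^sub>R (M *v x) + \<alpha> *\<^sub>R x)" for h
    by (simp add: inner_add_right sym[of x h] inner_commute[of x h] distrib_left)
  ultimately show "GDERIV (\<lambda>w. w \<bullet> (M *v w) + \<alpha> / 2 * (norm w)\<^sup>2 + c) x :> 2 *\<^sub>R (M *v x) + \<alpha> *\<^sub>R x"
    by (simp only: gderiv_def power2_norm_eq_inner)
qed

text \<open>A maximizer of the quadratic form on the unit sphere is an eigenvector by the
  first-order condition, and its value bounds every eigenvalue. So the \<open>GREATEST\<close> in
  \<open>max_eigenvalue\<close> exists.\<close>

lemma rayleigh_le_max_eigenvalue:
  fixes M :: "real^'n^'n"
  assumes "transpose M = M"
  shows "u \<bullet> (M *v u) \<le> max_eigenvalue M * (u \<bullet> u)"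
proof -
  have sym: "a \<bullet> (M *v b) = b \<bullet> (M *v a)" for a b
    by (metis assms dot_lmul_matrix inner_commute transpose_matrix_vector)
  let ?S = "sphere (0 :: real^'n) 1"
  have "axis undefined 1 \<in> ?S" by simp
  moreover have "continuous_on ?S (\<lambda>w. w \<bullet> (M *v w))"
    by (intro continuous_intros)
  ultimately obtain v where v: "v \<in> ?S" and max: "\<And>w. w \<in> ?S \<Longrightarrow> w \<bullet> (M *v w) \<le> v \<bullet> (M *v v)"
    using continuous_attains_sup[of ?S "\<lambda>w. w \<bullet> (M *v w)"] by (metis compact_sphere empty_iff)
  define l where "l = v \<bullet> (M *v v)"
  have vv: "v \<bullet> v = 1" using v by (simp add: norm_eq_sqrt_inner)
  have le: "w \<bullet> (M *v w) \<le> l * (w \<bullet> w)" for w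
  proof (cases "w = 0")
    case False
    then have "(w /\<^sub>R norm w) \<bullet> (M *v (w /\<^sub>R norm w)) \<le> l"
      unfolding l_def by (intro max) simp
    then have "(w \<bullet> (M *v w)) / (norm w)\<^sup>2 \<le> l"
      by (simp add: matrix_vector_mult_scaleR power2_eq_square divide_inverse mult_ac)
    with False show ?thesis
      by (simp add: divide_simps power2_norm_eq_inner mult.commute)
  qed simp
  have orth: "w \<bullet> (l *\<^sub>R v - M *v v) = 0" for w
  proof -
    let ?p = "w \<bullet> (l *\<^sub>R v - M *v v)" and ?q = "l * (w \<bullet> w) - w \<bullet> (M *v w)"
    have "0 \<le> 2 * ?p * t + ?q * t\<^sup>2" for t :: real
      using le[of "v + t *\<^sub>R w"] sym[of v w] vv l_def
      by (simp add: algebra_simps matrix_vector_mult_scaleR inner_commute[of v w] power2_eq_square)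
    \<comment> \<open>Nearly the minimizer \<open>- ?p / ?q\<close> of the quadratic in
      \<open>t\<close>; the added 1 keeps the denominator positive when
      \<open>?q = 0\<close>.\<close>
    from this[of "- ?p / (?q + 1)"] have 1: "0 \<le> - 2 * ?p * ?p / (?q + 1) + ?q * (?p / (?q + 1))\<^sup>2"
      by (simp add: power2_eq_square)
    have "0 \<le> ?q" using le[of w] by simp
    then have "- 2 * ?p * ?p / (?q + 1) + ?q * (?p / (?q + 1))\<^sup>2 = - (?p)\<^sup>2 * (?q + 2) / (?q + 1)\<^sup>2"
      by (simp add: divide_simps power2_eq_square) (simp add: algebra_simps)
    with 1 have "(?p)\<^sup>2 * (?q + 2) / (?q + 1)\<^sup>2 \<le> 0" by simp
    with \<open>0 \<le> ?q\<close> have "(?p)\<^sup>2 * (?q + 2) \<le> 0" by (simp add: divide_le_0_iff)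
    with \<open>0 \<le> ?q\<close> have "(?p)\<^sup>2 \<le> 0" by (simp add: mult_le_0_iff)
    then show ?thesis by simp
  qed
  have "eigenvalue M l"
    unfolding eigenvalue_def using orth[of "l *\<^sub>R v - M *v v"] vv by (intro exI[of _ v]) auto
  moreover have "k \<le> l" if k: "eigenvalue M k" for k
  proof -
    obtain w where w: "w \<noteq> 0" "M *v w = k *\<^sub>R w" using k by (auto simp: eigenvalue_def)
    with le[of w] show ?thesis by simp
  qed
  ultimately have "max_eigenvalue M = l"
    unfolding max_eigenvalue_def by (rule Greatest_equality)
  with le show ?thesis by simp
qed

text \<open>Compactness of \<open>Q\<close> and \<open>d \<noteq> 0\<close> make the set of
  admissible stepsizes compact, so the \<open>GREATEST\<close> in \<open>max_step\<close> is
  attained.\<close>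

lemma max_step_attained:
  fixes Q :: "'a::real_normed_vector set"
  assumes "compact Q" "w \<in> Q" "d \<noteq> 0"
  shows "0 \<le> max_step Q w d" "w + max_step Q w d *\<^sub>R d \<in> Q"
    "\<And>t. \<lbrakk>0 \<le> t; w + t *\<^sub>R d \<in> Q\<rbrakk> \<Longrightarrow> t \<le> max_step Q w d"
proof -
  let ?T = "{t. 0 \<le> t \<and> w + t *\<^sub>R d \<in> Q}"
  obtain B where B: "\<And>u. u \<in> Q \<Longrightarrow> norm u \<le> B"
    using compact_imp_bounded[OF assms(1)] by (auto simp: bounded_iff)
  have "norm t \<le> (B + norm w) / norm d" if "t \<in> ?T" for t
  proof -
    have "norm (t *\<^sub>R d) \<le> norm (w + t *\<^sub>R d) + norm w"
      using norm_triangle_ineq4[of "w + t *\<^sub>R d" w] by simp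
    also have "\<dots> \<le> B + norm w" using B that by auto
    finally show ?thesis using assms(3) by (simp add: field_simps)
  qed
  then have "bounded ?T" unfolding bounded_iff by blast
  moreover have "closed ?T"
  proof -
    have "closed ({0..} \<inter> (\<lambda>t. w + t *\<^sub>R d) -` Q)"
      by (intro closed_Int closed_atLeast closed_vimage compact_imp_closed assms continuous_intros)
    also have "{0..} \<inter> (\<lambda>t. w + t *\<^sub>R d) -` Q = ?T" by auto
    finally show ?thesis .
  qed
  ultimately have "compact ?T" by (simp add: compact_eq_bounded_closed)
  moreover have "?T \<noteq> {}" using assms(2) by (auto intro!: exI[of _ 0])
  ultimately obtain t where t: "t \<in> ?T" "\<And>u. u \<in> ?T \<Longrightarrow> u \<le> t"
    using compact_attains_sup[of ?T] by auto
  have "max_step Q w d = t"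
    unfolding max_step_def by (rule Greatest_equality) (use t in auto)
  with t show "0 \<le> max_step Q w d" "w + max_step Q w d *\<^sub>R d \<in> Q"
    "\<And>t. \<lbrakk>0 \<le> t; w + t *\<^sub>R d \<in> Q\<rbrakk> \<Longrightarrow> t \<le> max_step Q w d" by auto
qed

lemma fdfw_step_in:
  fixes Q :: "'a::real_inner set"
  assumes "compact Q" "convex Q" "w \<in> Q" "fdfw_step f Q w d a w'"
  shows "w' \<in> Q"
\<comment> \<open>For \<open>d = 0\<close> every stepsize is admissible and \<open>max_step\<close>
  is unspecified, but the point does not move.\<close>
proof (cases "stationary f Q w \<or> d = 0")
  case True
  with assms show ?thesis by (auto simp: fdfw_step_def split: if_splits)
next
  case False
  then have a: "0 < a" "a \<le> max_step Q w d" "w' = w + a *\<^sub>R d"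
    using assms by (auto simp: fdfw_step_def)
  let ?m = "max_step Q w d"
  have "(1 - a / ?m) *\<^sub>R w + (a / ?m) *\<^sub>R (w + ?m *\<^sub>R d) \<in> Q"
    using a False assms max_step_attained[OF assms(1,3), of d] by (intro convexD) (auto simp: field_simps)
  moreover have "(1 - a / ?m) *\<^sub>R w + (a / ?m) *\<^sub>R (w + ?m *\<^sub>R d) = w'"
    using a by (simp add: algebra_simps)
  ultimately show ?thesis by simp
qed

subsection \<open>The standard simplex\<close>

lemma std_simplexD:
  assumes "x \<in> std_simplex"
  shows "0 \<le> x $ i" "(\<Sum>i\<in>UNIV. x $ i) = 1" "x $ i \<le> 1"
proof -
  show 1: "0 \<le> x $ i" "(\<Sum>i\<in>UNIV. x $ i) = 1" for i
    using assms by (auto simp: std_simplex_def)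
  show "x $ i \<le> 1"
    using member_le_sum[of i UNIV "\<lambda>i. x $ i"] 1 by simp
qed

lemma axis_in_std_simplex: "axis i 1 \<in> std_simplex"
  by (simp add: std_simplex_def axis_def)

lemma compact_std_simplex: "compact (std_simplex :: (real^'n) set)"
proof -
  have "closed (std_simplex :: (real^'n) set)"
    unfolding std_simplex_def
    by (intro closed_Collect_conj closed_Collect_all closed_Collect_le closed_Collect_eq continuous_intros)
  moreover have "norm x \<le> 1" if "x \<in> std_simplex" for x :: "real^'n"
    using norm_le_l1_cart[of x] std_simplexD[OF that] by simp
  ultimately show ?thesis
    by (auto simp: compact_eq_bounded_closed bounded_iff)
qed

lemma convex_std_simplex: "convex std_simplex"
  by (auto simp: convex_def std_simplex_def sum.distrib simp flip: sum_distrib_left)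

text \<open>The end point of the longest move away from the vertex \<open>axis i 1\<close>:
  coordinate \<open>i\<close> is deleted and the rest rescaled to mass one. At that vertex itself,
  division by zero gives the zero vector, which is outside the simplex.\<close>

definition drop_coord :: "'n \<Rightarrow> real^'n \<Rightarrow> real^'n" where
  "drop_coord i x = (1 / (1 - x $ i)) *\<^sub>R (x - (x $ i) *\<^sub>R axis i 1)"

lemma drop_coord_nth: "drop_coord i x $ j = (if j = i then 0 else x $ j / (1 - x $ i))"
  by (simp add: drop_coord_def axis_def)

lemma drop_coord_eq_step:
  assumes "x $ i \<noteq> 1"
  shows "drop_coord i x = x + (x $ i / (1 - x $ i)) *\<^sub>R (x - axis i 1)"
  using assms by (auto simp: vec_eq_iff drop_coord_nth axis_def divide_simps) (auto simp: algebra_simps)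

lemma std_simplex_nth_less_1:
  assumes "x \<in> std_simplex" "x \<noteq> axis i 1"
  shows "x $ i < 1"
proof (rule ccontr)
  assume "\<not> x $ i < 1"
  with std_simplexD(3)[OF assms(1), of i] have 1: "x $ i = 1" by simp
  have "(\<Sum>j\<in>UNIV. x $ j) = x $ i + (\<Sum>j\<in>UNIV - {i}. x $ j)"
    by (simp add: sum.remove)
  then have "(\<Sum>j\<in>UNIV - {i}. x $ j) = 0"
    using 1 std_simplexD(2)[OF assms(1)] by simp
  then have "x $ j = 0" if "j \<noteq> i" for j
    using that std_simplexD(1)[OF assms(1)] by (subst (asm) sum_nonneg_eq_0_iff) auto
  with 1 have "x = axis i 1"
    by (auto simp: vec_eq_iff axis_def)
  with assms(2) show False by simp
qed

lemma drop_coord_in_std_simplex: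
  assumes "x \<in> std_simplex" "x \<noteq> axis i 1"
  shows "drop_coord i x \<in> std_simplex"
proof -
  have lt: "x $ i < 1" using std_simplex_nth_less_1[OF assms] .
  have "(\<Sum>j\<in>UNIV. drop_coord i x $ j) = ((\<Sum>j\<in>UNIV. x $ j) - x $ i) / (1 - x $ i)"
    by (simp add: drop_coord_def right_diff_distrib sum_subtractf axis_def flip: sum_divide_distrib)
      (simp add: diff_divide_distrib flip: sum_distrib_left)
  with lt show ?thesis
    using std_simplexD[OF assms(1)] by (auto simp: std_simplex_def drop_coord_nth)
qed

lemma supp_drop_coord: "x $ i \<noteq> 1 \<Longrightarrow> supp (drop_coord i x) = supp x - {i}"
  by (auto simp: supp_def drop_coord_nth)

text \<open>The vertex gets weight \<open>x $ i\<close>, the rescaled rest \<open>1 - x $ i\<close>.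
  Faces and extreme points are tested on this segment.\<close>

lemma open_segment_drop_coord:
  assumes "x \<in> std_simplex" "x \<noteq> axis i 1" "i \<in> supp x"
  shows "x \<in> open_segment (axis i 1) (drop_coord i x)"
proof -
  have lt: "x $ i < 1" "0 < x $ i"
    using std_simplex_nth_less_1[OF assms(1,2)] std_simplexD(1)[OF assms(1), of i] assms(3)
    by (auto simp: supp_def)
  have "axis i 1 \<noteq> drop_coord i x"
    by (metis axis_nth drop_coord_nth zero_neq_one)
  moreover have "x = (1 - (1 - x $ i)) *\<^sub>R axis i 1 + (1 - x $ i) *\<^sub>R drop_coord i x"
    using lt by (auto simp: vec_eq_iff drop_coord_nth axis_def)
  ultimately show ?thesis
    unfolding in_segment using lt by (intro conjI exI[of _ "1 - x $ i"]) auto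
qed

section \<open>Minimal faces and maximal away steps of the simplex\<close>

lemma minimal_face_face_of:
  assumes "convex Q" "w \<in> Q"
  shows "minimal_face Q w face_of Q" "w \<in> minimal_face Q w"
  unfolding minimal_face_def using face_of_refl[OF assms(1)] assms(2)
  by (auto intro!: face_of_Inter)

text \<open>A face meeting the interior of a segment contains both end points. Hence the away
  vertex, minimizing over the minimal face, can be compared with every vertex of the
  support.\<close>

lemma axis_in_minimal_face:
  assumes "x \<in> std_simplex" "i \<in> supp x"
  shows "axis i 1 \<in> minimal_face std_simplex x"
proof (cases "x = axis i 1")
  case True
  with minimal_face_face_of[OF convex_std_simplex assms(1)] show ?thesis by simp
next
  case False
  with minimal_face_face_of[OF convex_std_simplex assms(1)] open_segment_drop_coord[OF assms(1) False assms(2)]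
  show ?thesis
    by (meson assms(1) axis_in_std_simplex drop_coord_in_std_simplex face_ofD)
qed

text \<open>Identifies the away vertex of \<open>fdfw_direction\<close>: extreme points of the face
  are extreme in the simplex, hence coordinate vectors, and a coordinate vanishing at
  \<open>x\<close> vanishes on its minimal face.\<close>

lemma extreme_point_minimal_face:
  assumes x: "x \<in> std_simplex" and v: "v extreme_point_of minimal_face std_simplex x"
  obtains i where "i \<in> supp x" "v = axis i 1"
proof -
  have v': "v \<in> std_simplex" "v extreme_point_of std_simplex"
    using v minimal_face_face_of(1)[OF convex_std_simplex x] extreme_point_of_face extreme_point_of_def
    by (blast, blast)
  have "\<exists>i. v $ i \<noteq> 0"
    using std_simplexD(2)[OF v'(1)] by (metis sum.neutral zero_neq_one)
  then obtain i where i: "i \<in> supp v" by (auto simp: supp_def)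
  \<comment> \<open>Otherwise \<open>v\<close> would lie inside the segment from
    \<open>axis i 1\<close> to \<open>drop_coord i v\<close>.\<close>
  have v_eq: "v = axis i 1"
    using v'(2) open_segment_drop_coord[OF v'(1) _ i] drop_coord_in_std_simplex[OF v'(1), of i]
      axis_in_std_simplex[of i]
    unfolding extreme_point_of_def by blast
  let ?F = "{u \<in> std_simplex. u $ i = 0}"
  have "i \<in> supp x"
  proof (rule ccontr)
    assume "i \<notin> supp x"
    then have "x \<in> ?F" using x by (simp add: supp_def)
    moreover have "?F face_of std_simplex"
    proof -
      \<comment> \<open>The negative sign puts the simplex on the side where the functional is at
        most 0, as the supporting hyperplane rule requires.\<close>
      have "(std_simplex \<inter> {u. axis i (-1) \<bullet> u = 0}) face_of std_simplex"
        by (rule face_of_Int_supporting_hyperplane_le[OF convex_std_simplex])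
          (simp add: inner_axis' std_simplexD)
      moreover have "std_simplex \<inter> {u. axis i (-1) \<bullet> u = 0} = ?F"
        by (auto simp: inner_axis')
      ultimately show ?thesis by simp
    qed
    ultimately have "minimal_face std_simplex x \<subseteq> ?F"
      unfolding minimal_face_def by blast
    with v have "v $ i = 0" by (auto simp: extreme_point_of_def)
    with v_eq show False by simp
  qed
  with v_eq that show ?thesis by blast
qed

text \<open>After a move of length \<open>t\<close>, coordinate \<open>i\<close> equals
  \<open>x $ i - t * (1 - x $ i)\<close> and the others have not decreased, so feasibility ends when
  coordinate \<open>i\<close> reaches 0.\<close>

lemma max_step_away_vertex:
  assumes x: "x \<in> std_simplex" "i \<in> supp x" "x \<noteq> axis i 1"
  shows "max_step std_simplex x (x - axis i 1) = x $ i / (1 - x $ i)"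
proof -
  have lt: "x $ i < 1" "0 < x $ i"
    using std_simplex_nth_less_1[OF x(1,3)] std_simplexD(1)[OF x(1), of i] x(2)
    by (auto simp: supp_def)
  show ?thesis
    unfolding max_step_def
  proof (rule Greatest_equality)
    show "0 \<le> x $ i / (1 - x $ i) \<and> x + (x $ i / (1 - x $ i)) *\<^sub>R (x - axis i 1) \<in> std_simplex"
      using lt drop_coord_in_std_simplex[OF x(1,3)] drop_coord_eq_step[of x i] by simp
    fix t assume "0 \<le> t \<and> x + t *\<^sub>R (x - axis i 1) \<in> std_simplex"
    then have "0 \<le> (x + t *\<^sub>R (x - axis i 1)) $ i" using std_simplexD(1) by blast
    with lt show "t \<le> x $ i / (1 - x $ i)" by (simp add: field_simps)
  qed
qed

text \<open>Both points have mass one, so surplus and deficit have equal sums. Each deficit can only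
  shrink when a coordinate of \<open>x\<close> grows, which the signed form hides.\<close>

lemma l1_norm_diff_std_simplex:
  assumes "x \<in> std_simplex" "c \<in> std_simplex"
  shows "l1_norm (x - c) = 2 * (\<Sum>j\<in>UNIV. max 0 (c $ j - x $ j))"
proof -
  have "l1_norm (x - c) = (\<Sum>j\<in>UNIV. 2 * max 0 (c $ j - x $ j) + (x $ j - c $ j))"
    unfolding l1_norm_def by (intro sum.cong) (auto simp: max_def)
  also have "\<dots> = 2 * (\<Sum>j\<in>UNIV. max 0 (c $ j - x $ j))"
    using assms by (simp add: sum.distrib sum_subtractf std_simplexD(2) sum_distrib_left)
  finally show ?thesis .
qed

text \<open>Rescaling enlarges the other coordinates, so their deficits shrink; coordinate
  \<open>i\<close> has no deficit because \<open>c\<close> vanishes there.\<close>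

lemma l1_norm_drop_coord_le:
  assumes "x \<in> std_simplex" "x \<noteq> axis i 1" "c \<in> std_simplex" "i \<notin> supp c"
  shows "l1_norm (drop_coord i x - c) \<le> l1_norm (x - c)"
proof -
  have lt: "x $ i < 1" "0 \<le> x $ i"
    using std_simplex_nth_less_1[OF assms(1,2)] std_simplexD(1)[OF assms(1), of i] by auto
  have "x $ j \<le> x $ j / (1 - x $ i)" for j
    using lt std_simplexD(1)[OF assms(1), of j] by (simp add: field_simps mult_left_le)
  then have "max 0 (c $ j - drop_coord i x $ j) \<le> max 0 (c $ j - x $ j)" if "j \<noteq> i" for j
    using that by (intro max.mono diff_left_mono) (simp_all add: drop_coord_nth)
  moreover have "max 0 (c $ i - drop_coord i x $ i) \<le> max 0 (c $ i - x $ i)"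
    using assms(4) by (simp add: drop_coord_nth supp_def)
  ultimately have "max 0 (c $ j - drop_coord i x $ j) \<le> max 0 (c $ j - x $ j)" for j
    by (cases "j = i") simp_all
  then show ?thesis
    using assms drop_coord_in_std_simplex[OF assms(1,2)]
    by (simp add: l1_norm_diff_std_simplex sum_mono)
qed

text \<open>Subtracting \<open>1/2\<close> from all coefficients does not change the sum, since \<open>x - c\<close> has mass zero.\<close>

lemma partial_mass_diff_le:
  assumes "x \<in> std_simplex" "c \<in> std_simplex" and b: "\<And>j. b j \<in> {0, 1 :: real}"
  shows "\<bar>\<Sum>j\<in>UNIV. b j * (x $ j - c $ j)\<bar> \<le> l1_norm (x - c) / 2"
proof -
  have "(\<Sum>j\<in>UNIV. b j * (x $ j - c $ j)) = (\<Sum>j\<in>UNIV. (b j - 1/2) * (x $ j - c $ j))"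
    using assms(1,2) by (simp add: left_diff_distrib sum_subtractf std_simplexD(2) flip: sum_divide_distrib)
  also have "\<bar>\<dots>\<bar> \<le> (\<Sum>j\<in>UNIV. \<bar>(b j - 1/2) * (x $ j - c $ j)\<bar>)"
    by (rule sum_abs)
  also have "\<dots> = (\<Sum>j\<in>UNIV. \<bar>x $ j - c $ j\<bar> / 2)"
  proof (intro sum.cong refl)
    fix j
    have "\<bar>b j - 1/2\<bar> = 1/2" using b[of j] by auto
    then show "\<bar>(b j - 1/2) * (x $ j - c $ j)\<bar> = \<bar>x $ j - c $ j\<bar> / 2" by (simp add: abs_mult)
  qed
  finally show ?thesis by (simp add: l1_norm_def sum_divide_distrib)
qed

lemma clique_center_nth: "clique_center C $ j = (if j \<in> C then 1 / real (card C) else 0)"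
  by (simp add: clique_center_def axis_def)

lemma clique_center_in_std_simplex: "C \<noteq> {} \<Longrightarrow> clique_center C \<in> std_simplex"
  by (simp add: std_simplex_def clique_center_nth sum.If_cases card_eq_0_iff)

lemma supp_clique_center: "supp (clique_center C) = C"
  by (auto simp: supp_def clique_center_nth card_eq_0_iff)

text \<open>A missing vertex of \<open>C\<close> alone causes a deficit of
  \<open>1 / card C\<close>, which costs twice that in the distance.\<close>

lemma supp_superset_of_close:
  assumes "x \<in> std_simplex" "C \<noteq> {}" "l1_norm (x - clique_center C) < 2 / real (card C)"
  shows "C \<subseteq> supp x"
proof
  fix j assume j: "j \<in> C"
  let ?c = "clique_center C"
  have "max 0 (?c $ j - x $ j) \<le> (\<Sum>j\<in>UNIV. max 0 (?c $ j - x $ j))"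
    by (intro member_le_sum) auto
  also have "\<dots> = l1_norm (x - ?c) / 2"
    using l1_norm_diff_std_simplex[OF assms(1) clique_center_in_std_simplex[OF assms(2)]] by simp
  finally have "max 0 (1 / real (card C) - x $ j) < 1 / real (card C)"
    using assms(3) j by (auto simp: clique_center_nth simp del: max_less_iff_conj)
  then show "j \<in> supp x" by (auto simp: supp_def max_def split: if_splits)
qed

subsection \<open>Away steps on the simplex\<close>

text \<open>Coordinate \<open>i\<close> contributes \<open>(1 - x $ i)\<^sup>2\<close>. The others
  are nonnegative with sum \<open>1 - x $ i\<close>, so their squares sum to at most the same
  amount.\<close>

lemma norm_away_direction_le:
  assumes x: "x \<in> std_simplex"
  shows "(norm (x - axis i 1))\<^sup>2 \<le> 2 * (1 - x $ i)\<^sup>2"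
proof -
  have le: "x $ j * x $ j \<le> x $ j * (1 - x $ i)" if "j \<noteq> i" for j
  proof -
    have "(\<Sum>k\<in>{i, j}. x $ k) \<le> (\<Sum>k\<in>UNIV. x $ k)"
      by (rule sum_mono2) (auto simp: std_simplexD[OF x])
    then have "x $ j \<le> 1 - x $ i" using that by (simp add: std_simplexD[OF x])
    then show ?thesis by (intro mult_left_mono std_simplexD[OF x])
  qed
  have rest: "(\<Sum>j\<in>UNIV - {i}. x $ j) = 1 - x $ i"
    using sum.remove[of UNIV i "\<lambda>j. x $ j"] std_simplexD(2)[OF x] by simp
  have "(norm (x - axis i 1))\<^sup>2 = (1 - x $ i)\<^sup>2 + (\<Sum>j\<in>UNIV - {i}. x $ j * x $ j)"
    unfolding power2_norm_eq_inner inner_vec_def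
    by (simp add: sum.remove[of UNIV i] axis_def power2_eq_square) (simp add: algebra_simps)
  also have "(\<Sum>j\<in>UNIV - {i}. x $ j * x $ j) \<le> (\<Sum>j\<in>UNIV - {i}. x $ j * (1 - x $ i))"
    by (rule sum_mono) (use le in auto)
  also have "\<dots> = (1 - x $ i)\<^sup>2"
    by (simp add: rest power2_eq_square flip: sum_distrib_right)
  finally show ?thesis by simp
qed

text \<open>The inequalities behind one step, for an abstract gradient \<open>g\<close> with level
  \<open>\<gamma>\<close> on \<open>C\<close> and gap \<open>\<Delta>\<close>. The last two
  conclusions let the away direction win strictly over every Frank-Wolfe direction and let the lower
  bound on the stepsize reach the maximal step.\<close>

lemma away_vertex_dominates:
  fixes g x :: "real^'n"
  assumes x: "x \<in> std_simplex"
    and mass: "(\<Sum>j\<in>-C. x $ j) \<le> \<epsilon> / 2"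
    and inC: "\<And>j. j \<in> C \<Longrightarrow> \<bar>g $ j - \<gamma>\<bar> \<le> L * \<epsilon> / 2"
    and outC: "\<And>j. j \<notin> C \<Longrightarrow> g $ j \<le> \<gamma> - \<Delta> + L * \<epsilon> / 2"
    and L: "0 < L" and \<Delta>: "0 < \<Delta>" "2 * L * \<epsilon> \<le> \<Delta> * (1 - \<epsilon>)"
    and ne: "supp x - C \<noteq> {}"
    and i: "i \<in> supp x" "\<And>j. j \<in> supp x \<Longrightarrow> g $ i \<le> g $ j"
  shows "i \<notin> C" "x $ i < 1"
    "\<And>u. u \<in> std_simplex \<Longrightarrow> g \<bullet> (u - x) < g \<bullet> (x - axis i 1)"
    "x $ i / (1 - x $ i) \<le> 1 / L * (g \<bullet> (x - axis i 1) / (norm (x - axis i 1))\<^sup>2)"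
proof -
  define p where "p = (\<Sum>j\<in>-C. x $ j)"
  define h where "h = L * \<epsilon> / 2"
  have le_p: "x $ j \<le> p" if "j \<notin> C" for j
    unfolding p_def by (rule member_le_sum) (use that in \<open>auto simp: std_simplexD[OF x]\<close>)
  obtain j0 where j0: "j0 \<in> supp x" "j0 \<notin> C" using ne by auto
  then have "0 < x $ j0"
    using std_simplexD(1)[OF x, of j0] by (simp add: supp_def)
  with le_p[OF j0(2)] have p: "0 < p" by simp
  have \<epsilon>: "0 < \<epsilon>" "2 * p \<le> \<epsilon>" using p mass by (auto simp: p_def)
  have h: "0 < h" using L \<epsilon> by (simp add: h_def)
  \<comment> \<open>The budget for the later estimates: four times \<open>h\<close>, the error bound
    for one gradient entry. Positivity of \<open>h\<close> also forces
    \<open>\<epsilon> < 1\<close>.\<close>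
  have \<Delta>\<epsilon>: "4 * h \<le> \<Delta> * (1 - \<epsilon>)" using \<Delta>(2) by (simp add: h_def)
  with h have "0 < \<Delta> * (1 - \<epsilon>)" by linarith
  with \<Delta>(1) have \<epsilon>1: "\<epsilon> < 1" by (simp add: zero_less_mult_iff)
  have "\<Delta> * (1 - \<epsilon>) \<le> \<Delta> * 1" using \<Delta>(1) \<epsilon>(1) by (intro mult_left_mono) auto
  with \<Delta>\<epsilon> have \<Delta>h: "4 * h \<le> \<Delta>" by simp
  have gi: "g $ i \<le> \<gamma> - \<Delta> + h"
    using i(2)[OF j0(1)] outC[OF j0(2)] by (simp add: h_def)
  show "i \<notin> C"
  proof
    assume "i \<in> C"
    from inC[OF this] gi \<Delta>h h show False by (simp add: h_def)
  qed
  then have xi: "x $ i \<le> p" by (rule le_p)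
  with \<epsilon> \<epsilon>1 show xi1: "x $ i < 1" by simp
  have xi0: "0 < x $ i"
    using i(1) std_simplexD(1)[OF x, of i] by (simp add: supp_def)
  have massC: "(\<Sum>j\<in>C. x $ j) = 1 - p"
    using sum.Int_Diff[of UNIV "\<lambda>j. x $ j" C] std_simplexD(2)[OF x]
    by (simp add: p_def Compl_eq_Diff_UNIV)
  \<comment> \<open>The average \<open>g \<bullet> x\<close> is split: mass \<open>1 - p\<close> on
    \<open>C\<close> at level at least \<open>\<gamma> - h\<close>, mass \<open>p\<close> outside at
    level at least \<open>g $ i\<close>.\<close>
  have "(\<Sum>j\<in>C. x $ j * (\<gamma> - h)) \<le> (\<Sum>j\<in>C. x $ j * g $ j)"
  proof (intro sum_mono mult_left_mono std_simplexD[OF x])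
    show "\<gamma> - h \<le> g $ j" if "j \<in> C" for j
      using inC[OF that] unfolding h_def by linarith
  qed
  moreover have "(\<Sum>j\<in>-C. x $ j * g $ i) \<le> (\<Sum>j\<in>-C. x $ j * g $ j)"
  proof (rule sum_mono)
    show "x $ j * g $ i \<le> x $ j * g $ j" for j
      using i(2)[of j] std_simplexD(1)[OF x, of j] by (cases "j \<in> supp x") (auto simp: supp_def mult_left_mono)
  qed
  moreover have "g \<bullet> x = (\<Sum>j\<in>C. x $ j * g $ j) + (\<Sum>j\<in>-C. x $ j * g $ j)"
    using sum.Int_Diff[of UNIV "\<lambda>j. x $ j * g $ j" C]
    by (simp add: inner_vec_def Compl_eq_Diff_UNIV mult.commute)
  ultimately have gx: "(1 - p) * (\<gamma> - h) + p * g $ i \<le> g \<bullet> x"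
    by (simp add: massC p_def flip: sum_distrib_right)
  have gain: "g \<bullet> (x - axis i 1) = g \<bullet> x - g $ i"
    by (simp add: inner_diff_right inner_axis)
  show "g \<bullet> (u - x) < g \<bullet> (x - axis i 1)" if u: "u \<in> std_simplex" for u
  proof -
    have "g $ j \<le> \<gamma> + h" for j
      using inC[of j] outC[of j] \<Delta>h h unfolding h_def by (cases "j \<in> C") linarith+
    then have "(\<Sum>j\<in>UNIV. u $ j * g $ j) \<le> (\<Sum>j\<in>UNIV. u $ j * (\<gamma> + h))"
      by (intro sum_mono mult_left_mono std_simplexD[OF u])
    then have gu: "g \<bullet> u \<le> \<gamma> + h"
      by (simp add: inner_vec_def mult.commute std_simplexD[OF u] flip: sum_distrib_right)
    \<comment> \<open>The goal reduces to
      \<open>(3 - 2 * p) * h < (1 - 2 * p) * (\<gamma> - g $ i)\<close>. The right side is at least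
      \<open>4 * h - (1 - 2 * p) * h\<close>, which leaves the strict slack
      \<open>4 * p * h\<close>.\<close>
    have "\<Delta> * (1 - \<epsilon>) \<le> \<Delta> * (1 - 2 * p)" using \<Delta>(1) \<epsilon>(2) by (intro mult_left_mono) auto
    moreover have "0 < p * h" using p h by simp
    moreover have "(1 - 2 * p) * (\<Delta> - h) \<le> (1 - 2 * p) * (\<gamma> - g $ i)"
      using gi \<epsilon>(2) \<epsilon>1 by (intro mult_left_mono) auto
    ultimately have "\<gamma> + h + g $ i < 2 * ((1 - p) * (\<gamma> - h) + p * g $ i)"
      using \<Delta>\<epsilon> by (simp add: algebra_simps)
    with gu gx show ?thesis unfolding gain by (simp add: inner_diff_right)
  qed
  have p1: "p < 1" using \<epsilon> \<epsilon>1 by linarith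
  \<comment> \<open>By the norm bound,
    \<open>2 * L * x $ i * (1 - x $ i) \<le> g \<bullet> (x - axis i 1)\<close> suffices. The map
    \<open>t * (1 - t)\<close> does not decrease from \<open>x $ i\<close> to \<open>p\<close>,
    since \<open>x $ i \<le> p\<close> and \<open>x $ i + p < 1\<close>.\<close>
  have "x $ i * (1 - x $ i) * (2 * L) \<le> p * (1 - p) * (2 * L)"
  proof -
    have "0 \<le> (p - x $ i) * (1 - p - x $ i)"
      using xi \<epsilon> \<epsilon>1 by (intro mult_nonneg_nonneg) linarith+
    then have "x $ i * (1 - x $ i) \<le> p * (1 - p)" by (simp add: algebra_simps)
    with L show ?thesis by simp
  qed
  also have "\<dots> \<le> (1 - p) * (2 * h)"
    using \<epsilon>(2) L p1 by (simp add: h_def)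
  also have "\<dots> \<le> (1 - p) * (\<gamma> - h - g $ i)"
    using gi \<Delta>h p1 by (intro mult_left_mono) auto
  also have "\<dots> \<le> g \<bullet> (x - axis i 1)"
    using gx unfolding gain by (simp add: algebra_simps)
  finally have key: "x $ i * (1 - x $ i) * (2 * L) \<le> g \<bullet> (x - axis i 1)" .
  have "x \<noteq> axis i 1" using xi1 by auto
  then have n: "0 < (norm (x - axis i 1))\<^sup>2" by simp
  have "(x $ i / (1 - x $ i)) * (L * (norm (x - axis i 1))\<^sup>2)
      \<le> (x $ i / (1 - x $ i)) * (L * (2 * (1 - x $ i)\<^sup>2))"
    using xi0 xi1 L norm_away_direction_le[OF x, of i] by (intro mult_left_mono) auto
  also have "\<dots> = x $ i * (1 - x $ i) * (2 * L)"
    using xi1 by (simp add: power2_eq_square)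
  also note key
  finally show "x $ i / (1 - x $ i) \<le> 1 / L * (g \<bullet> (x - axis i 1) / (norm (x - axis i 1))\<^sup>2)"
    using n L by (simp add: pos_le_divide_eq mult_ac)
qed

text \<open>Transfers the inequalities to the algorithm: the away direction is chosen and followed
  to the boundary, which deletes exactly one coordinate, outside \<open>C\<close>.\<close>

lemma fdfw_step_drops_vertex:
  fixes f :: "real^'n \<Rightarrow> real"
  assumes x: "x \<in> std_simplex"
    and mass: "(\<Sum>j\<in>-C. x $ j) \<le> \<epsilon> / 2"
    and inC: "\<And>j. j \<in> C \<Longrightarrow> \<bar>gradient f x $ j - \<gamma>\<bar> \<le> L * \<epsilon> / 2"
    and outC: "\<And>j. j \<notin> C \<Longrightarrow> gradient f x $ j \<le> \<gamma> - \<Delta> + L * \<epsilon> / 2"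
    and L: "0 < L" and \<Delta>: "0 < \<Delta>" "2 * L * \<epsilon> \<le> \<Delta> * (1 - \<epsilon>)"
    and ne: "supp x - C \<noteq> {}"
    and step: "fdfw_direction f std_simplex x d" "a \<le> max_step std_simplex x d" "x' = x + a *\<^sub>R d"
    and size: "min (max_step std_simplex x d) (1 / L * (gradient f x \<bullet> d / (norm d)\<^sup>2)) \<le> a"
  obtains i where "i \<in> supp x - C" "x $ i < 1" "x' = drop_coord i x"
proof -
  let ?g = "gradient f x"
  obtain u v where u: "is_arg_max (\<lambda>u. ?g \<bullet> u) (\<lambda>u. u \<in> std_simplex) u"
    and v: "is_arg_min (\<lambda>u. ?g \<bullet> u) (\<lambda>u. u \<in> minimal_face std_simplex x) v"
      "v extreme_point_of minimal_face std_simplex x"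
    and d: "d = (if ?g \<bullet> (u - x) \<ge> ?g \<bullet> (x - v) then u - x else x - v)"
    using step(1) unfolding fdfw_direction_def by blast
  obtain i where i: "i \<in> supp x" "v = axis i 1"
    using extreme_point_minimal_face[OF x v(2)] .
  have min: "?g $ i \<le> ?g $ j" if "j \<in> supp x" for j
    using v(1) axis_in_minimal_face[OF x that] by (auto simp: is_arg_min_linorder i(2) inner_axis)
  note dom = away_vertex_dominates[OF x mass inC outC L \<Delta> ne i(1) min]
  \<comment> \<open>Strictness matters: a tie would select the Frank-Wolfe direction.\<close>
  have d_eq: "d = x - axis i 1"
    using d dom(3)[of u] u i(2) by (auto simp: is_arg_max_def)
  have "x \<noteq> axis i 1" using dom(2) by auto
  \<comment> \<open>By \<open>dom(4)\<close> the minimum in \<open>size\<close> is the maximal step,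
    so \<open>a\<close> is squeezed onto it.\<close>
  then have "a = x $ i / (1 - x $ i)"
    using step(2) size dom(4) max_step_away_vertex[OF x i(1)] by (auto simp: d_eq)
  then have "x' = drop_coord i x"
    using step(3) dom(2) by (simp add: d_eq drop_coord_eq_step)
  with dom(1,2) i(1) that show ?thesis by blast
qed

text \<open>At a stationary point every gradient entry is at most the average
  \<open>g \<bullet> x\<close>, so all entries on the support equal it; a smaller entry there would
  push the average below itself.\<close>

lemma not_stationary_std_simplex:
  assumes x: "x \<in> std_simplex" and "i \<in> supp x" "gradient f x $ i < gradient f x $ j"
  shows "\<not> stationary f std_simplex x"
proof
  let ?g = "gradient f x"
  assume "stationary f std_simplex x"
  then have le: "?g $ k \<le> ?g \<bullet> x" for k
    using axis_in_std_simplex[of k] by (auto simp: stationary_def inner_diff_right inner_axis)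
  have "(\<Sum>k\<in>UNIV. x $ k * ?g $ k) < (\<Sum>k\<in>UNIV. x $ k * (?g \<bullet> x))"
  proof (rule sum_strict_mono_ex1)
    show "\<forall>k\<in>UNIV. x $ k * ?g $ k \<le> x $ k * (?g \<bullet> x)"
      by (simp add: le mult_left_mono std_simplexD[OF x])
    have "0 < x $ i" using assms(2) std_simplexD(1)[OF x, of i] by (simp add: supp_def)
    then have "x $ i * ?g $ i < x $ i * (?g \<bullet> x)"
      using assms(3) le[of j] by simp
    then show "\<exists>k\<in>UNIV. x $ k * ?g $ k < x $ k * (?g \<bullet> x)" by blast
  qed simp
  then show False
    by (simp add: inner_vec_def mult.commute std_simplexD[OF x] flip: sum_distrib_right)
qed

subsection \<open>Adjacency matrices and cliques\<close>

text \<open>Separates the spectral and counting arguments from the encoding of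
  \<open>y\<close>.\<close>

locale adjacency_matrix =
  fixes M :: "real^'n^'n"
  assumes entry: "M $ i $ j \<in> {0, 1}"
    and sym: "M $ i $ j = M $ j $ i"
    and diag: "M $ i $ i = 0"
begin

lemma transpose_eq: "transpose M = M"
  unfolding transpose_def vec_eq_iff using sym by simp

lemma row_sum_clique:
  assumes "\<And>i j. \<lbrakk>i \<in> K; j \<in> K; i \<noteq> j\<rbrakk> \<Longrightarrow> M $ i $ j = 1" "i \<in> K"
  shows "(\<Sum>j\<in>K. M $ i $ j) = real (card K) - 1"
proof -
  have "(\<Sum>j\<in>K. M $ i $ j) = (\<Sum>j\<in>K - {i}. M $ i $ j)"
    using assms(2) diag by (simp add: sum.remove)
  also have "\<dots> = (\<Sum>j\<in>K - {i}. 1)"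
    by (rule sum.cong) (use assms in auto)
  also have "\<dots> = real (card K) - 1"
    using assms(2) by (cases "card K") auto
  finally show ?thesis .
qed

text \<open>The Rayleigh quotient of the indicator vector of \<open>K\<close> is
  \<open>card K - 1\<close>.\<close>

lemma clique_card_le_max_eigenvalue:
  assumes "\<And>i j. \<lbrakk>i \<in> K; j \<in> K; i \<noteq> j\<rbrakk> \<Longrightarrow> M $ i $ j = 1" "K \<noteq> {}"
  shows "real (card K) - 1 \<le> max_eigenvalue M"
proof -
  define u :: "real^'n" where "u = (\<chi> i. if i \<in> K then 1 else 0)"
  have *: "(if i \<in> K then 1 else 0) * r = (if i \<in> K then r else 0)"
    "r * (if i \<in> K then 1 else 0) = (if i \<in> K then r else 0)" for r :: real and i
    by auto
  have Mu: "(M *v u) $ i = (\<Sum>j\<in>K. M $ i $ j)" for i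
    by (simp add: u_def matrix_vector_mult_def * sum.If_cases)
  have "u \<bullet> (M *v u) = (\<Sum>i\<in>K. \<Sum>j\<in>K. M $ i $ j)"
    by (simp add: inner_vec_def Mu) (simp add: u_def * sum.If_cases)
  also have "\<dots> = real (card K) * (real (card K) - 1)"
    using row_sum_clique[OF assms(1)] by simp
  finally have "u \<bullet> (M *v u) = real (card K) * (real (card K) - 1)" .
  moreover have "u \<bullet> u = real (card K)"
    by (simp add: inner_vec_def u_def * sum.If_cases)
  moreover have "0 < real (card K)" using assms(2) by (simp add: card_gt_0_iff)
  ultimately show ?thesis
    using rayleigh_le_max_eigenvalue[OF transpose_eq, of u] by simp
qed

lemma max_eigenvalue_nonneg: "0 \<le> max_eigenvalue M"
  using clique_card_le_max_eigenvalue[of "{undefined}"] by simp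

text \<open>An edge is a clique of size two.\<close>

lemma entry_le_max_eigenvalue: "M $ i $ j \<le> max_eigenvalue M"
proof (cases "M $ i $ j = 1")
  case True
  then have "i \<noteq> j" using diag by force
  with True clique_card_le_max_eigenvalue[of "{i, j}"] show ?thesis
    using sym[of i j] by auto
next
  case False
  with entry[of i j] max_eigenvalue_nonneg show ?thesis by auto
qed

text \<open>Rows of \<open>M\<close> are 0/1 vectors, so the partial mass bound gives half the
  distance. The factor \<open>max_eigenvalue M\<close> is harmless: a zero row contributes nothing,
  and a nonzero row forces it to be at least 1.\<close>

lemma gradient_lipschitz_l1:
  assumes x: "x \<in> std_simplex" and c: "c \<in> std_simplex" and "0 \<le> \<alpha>"
  shows "\<bar>(2 *\<^sub>R (M *v x) + \<alpha> *\<^sub>R x) $ j - (2 *\<^sub>R (M *v c) + \<alpha> *\<^sub>R c) $ j\<bar>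
    \<le> (2 * max_eigenvalue M + \<alpha>) * l1_norm (x - c) / 2"
proof -
  let ?\<epsilon> = "l1_norm (x - c)"
  have \<epsilon>: "0 \<le> ?\<epsilon>" by (simp add: l1_norm_def sum_nonneg)
  have Mr: "(M *v x) $ j - (M *v c) $ j = (\<Sum>k\<in>UNIV. M $ j $ k * (x $ k - c $ k))"
    by (simp add: matrix_vector_mult_def right_diff_distrib sum_subtractf)
  have 1: "\<bar>(M *v x) $ j - (M *v c) $ j\<bar> \<le> max_eigenvalue M * ?\<epsilon> / 2"
  proof (cases "\<forall>k. M $ j $ k = 0")
    case True
    then show ?thesis unfolding Mr using max_eigenvalue_nonneg \<epsilon> by simp
  next
    case False
    then obtain k where "M $ j $ k \<noteq> 0" by blast
    then have "1 \<le> max_eigenvalue M" using entry[of j k] entry_le_max_eigenvalue[of j k] by auto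
    then have "?\<epsilon> / 2 \<le> max_eigenvalue M * ?\<epsilon> / 2"
      using \<epsilon> mult_right_mono[of 1 "max_eigenvalue M" ?\<epsilon>] by simp
    with partial_mass_diff_le[OF x c, of "\<lambda>k. M $ j $ k"] entry show ?thesis
      unfolding Mr by fastforce
  qed
  have 2: "\<bar>x $ j - c $ j\<bar> \<le> ?\<epsilon> / 2"
    using partial_mass_diff_le[OF x c, of "\<lambda>k. if k = j then 1 else 0"]
    by (simp add: if_distrib[of "\<lambda>t. t * _"] cong: if_cong)
  have "\<bar>(2 *\<^sub>R (M *v x) + \<alpha> *\<^sub>R x) $ j - (2 *\<^sub>R (M *v c) + \<alpha> *\<^sub>R c) $ j\<bar>
      = \<bar>2 * ((M *v x) $ j - (M *v c) $ j) + \<alpha> * (x $ j - c $ j)\<bar>"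
    by (simp add: algebra_simps)
  also have "\<dots> \<le> 2 * \<bar>(M *v x) $ j - (M *v c) $ j\<bar> + \<alpha> * \<bar>x $ j - c $ j\<bar>"
    by (rule order_trans[OF abs_triangle_ineq]) (simp only: abs_mult, use \<open>0 \<le> \<alpha>\<close> in simp)
  also have "\<dots> \<le> 2 * (max_eigenvalue M * ?\<epsilon> / 2) + \<alpha> * (?\<epsilon> / 2)"
    using 1 2 \<open>0 \<le> \<alpha>\<close> by (intro add_mono mult_left_mono) auto
  finally show ?thesis by (simp add: algebra_simps)
qed

lemma mult_clique_center: "(M *v clique_center C) $ j = (\<Sum>k\<in>C. M $ j $ k) / real (card C)"
  by (simp add: matrix_vector_mult_def clique_center_nth if_distrib[of "\<lambda>t. _ * t"]
      sum.If_cases sum_divide_distrib cong: if_cong)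

end

section \<open>The augmented graph, clique defects and feasibility of the iterates\<close>

lemma D_set_subset: "D_set E s \<subseteq> D'_set E s"
  by (fastforce simp: D_set_def D'_set_def)

lemma adjacency_matrix_aug:
  assumes "simple_graph E" "y \<in> D_set E s"
  shows "adjacency_matrix (adj_matrix E + A_mat E y)"
proof
  fix i j
  have "y $ {i, j} \<in> {0, 1}" if "{i, j} \<in> compl_edges E"
    using assms(2) that by (auto simp: D_set_def)
  moreover have "{i, j} \<in> E \<Longrightarrow> {i, j} \<notin> compl_edges E" by (simp add: compl_edges_def)
  ultimately show "(adj_matrix E + A_mat E y) $ i $ j \<in> {0, 1}"
    by (auto simp: adj_matrix_def A_mat_def)
  show "(adj_matrix E + A_mat E y) $ i $ j = (adj_matrix E + A_mat E y) $ j $ i"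
    by (simp add: adj_matrix_def A_mat_def insert_commute)
  have "{i, i} \<notin> E" "{i, i} \<notin> compl_edges E"
    using assms(1) by (auto simp: simple_graph_def compl_edges_def)
  then show "(adj_matrix E + A_mat E y) $ i $ i = 0"
    by (simp add: adj_matrix_def A_mat_def)
qed

text \<open>Symmetry of the matrix makes the test independent of the order in which an edge is
  written.\<close>

lemma mem_aug_edges_iff: "{i, j} \<in> aug_edges E y \<longleftrightarrow> (adj_matrix E + A_mat E y) $ i $ j = 1"
  unfolding aug_edges_def by (auto simp: doubleton_eq_iff adj_matrix_def A_mat_def insert_commute)

lemma card_neighbors_aug:
  assumes "simple_graph E" "y \<in> D_set E s"
  shows "real (card (neighbors (aug_edges E y) v \<inter> C))
    = (\<Sum>k\<in>C. (adj_matrix E + A_mat E y) $ v $ k)"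
proof -
  interpret adjacency_matrix "adj_matrix E + A_mat E y" using adjacency_matrix_aug[OF assms] .
  have "(adj_matrix E + A_mat E y) $ v $ k = (if k \<in> neighbors (aug_edges E y) v then 1 else 0)" for k
    using entry[of v k] mem_aug_edges_iff[of v k E y] by (auto simp: neighbors_def)
  then show ?thesis
    by (simp add: sum.If_cases Int_commute)
qed

text \<open>The minimum is attained and is a natural number. The value 0 means that some vertex
  extends the clique.\<close>

lemma m_clique_cases:
  assumes "C \<noteq> UNIV"
  shows "m_clique C F = 0 \<and> (\<exists>v. v \<notin> C \<and> C \<subseteq> neighbors F v) \<or> 1 \<le> m_clique C F"
proof -
  have "m_clique C F \<in> (\<lambda>v. real (card C) - real (card (neighbors F v \<inter> C))) ` (UNIV - C)"
    unfolding m_clique_def using assms by (intro Min_in) auto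
  then obtain v where v: "v \<notin> C" "m_clique C F = real (card C) - real (card (neighbors F v \<inter> C))"
    by auto
  show ?thesis
  proof (cases "C \<subseteq> neighbors F v")
    case True
    then show ?thesis using v by (auto simp: Int_absorb1)
  next
    case False
    then have "card (neighbors F v \<inter> C) < card C" by (intro psubset_card_mono) auto
    then show ?thesis using v(2) by simp
  qed
qed

lemma m_clique_le: "v \<notin> C \<Longrightarrow> m_clique C F \<le> real (card C) - real (card (neighbors F v \<inter> C))"
  unfolding m_clique_def by (rule Min_le) auto

lemma fwdc_sequence_in_std_simplex:
  assumes "fwdc_sequence E s \<alpha> \<beta> x y d a"
  shows "x k \<in> std_simplex"
proof (induction k)
  case 0
  show ?case using assms by (simp add: fwdc_sequence_def P_set_def)
next
  case (Suc k)
  show ?case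
  proof (cases "stationary (h_obj E \<alpha> \<beta>) (P_set E s) (x k, y k)")
    case True
    with assms Suc show ?thesis by (simp add: fwdc_sequence_def)
  next
    case False
    with assms have "fdfw_step (\<lambda>w. h_obj E \<alpha> \<beta> (w, y k)) std_simplex (x k) (d k) (a k) (x (Suc k))"
      by (simp add: fwdc_sequence_def)
    with Suc show ?thesis by (rule fdfw_step_in[OF compact_std_simplex convex_std_simplex])
  qed
qed

subsection \<open>Identification of the clique\<close>

theorem proposition5p2:
  fixes E :: "'n::finite set set" and s :: nat and \<alpha> \<beta> :: real
    and x :: "nat \<Rightarrow> real^'n" and y :: "nat \<Rightarrow> real^('n set)"
    and d :: "nat \<Rightarrow> real^'n" and a :: "nat \<Rightarrow> real"
    and ybar :: "real^('n set)" and C Ic :: "'n set" and kbar :: nat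
    and \<delta>max L malpha :: real
  assumes graph: "simple_graph E"
    and s: "s \<le> card (compl_edges E)"
    and alpha: "0 < \<alpha>" "\<alpha> < 2"
    and beta: "0 < \<beta>"
    and seq: "fwdc_sequence E s \<alpha> \<beta> x y d a"
    and ybar: "ybar \<in> D_set E s"
    and C: "C \<noteq> {}" "C \<noteq> UNIV" "clique C (aug_edges E ybar)"
    and delta: "\<delta>max = max_eigenvalue (adj_matrix E + A_mat E ybar)"
    and Ic: "Ic = supp (x kbar) - C"
    and L: "L = 2 * \<delta>max + \<alpha>"
    and malpha: "malpha = m_clique_alpha \<alpha> C (aug_edges E ybar)"
    and y_const: "\<And>j. j \<le> card Ic \<Longrightarrow> y (kbar + j) = ybar"
    and stepsize: "\<And>k. x_step_taken E s \<alpha> \<beta> (x k) (y k) \<Longrightarrow>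
          a k \<ge> min (max_step std_simplex (x k) (d k))
                    (1 / L * ((gradient (\<lambda>w. h_obj E \<alpha> \<beta> (w, y k)) (x k) \<bullet> d k) / (norm (d k))\<^sup>2))"
    and close: "l1_norm (x kbar - clique_center C)
          \<le> malpha / (malpha + 2 * real (card C) * \<delta>max + real (card C) * \<alpha>)"
  shows "supp (x (kbar + card Ic)) = C"
proof -
  define M where "M = adj_matrix E + A_mat E ybar"
  let ?F = "aug_edges E ybar" and ?c = "clique_center C"
  interpret adjacency_matrix M
    unfolding M_def using adjacency_matrix_aug[OF graph ybar] .
  have \<delta>: "\<delta>max = max_eigenvalue M" by (simp add: delta M_def)
  have clique: "M $ i $ j = 1" if "i \<in> C" "j \<in> C" "i \<noteq> j" for i j
    using C(3) that unfolding clique_def M_def by (metis mem_aug_edges_iff)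
  have deg: "real (card (neighbors ?F v \<inter> C)) = (\<Sum>k\<in>C. M $ v $ k)" for v
    unfolding M_def by (rule card_neighbors_aug[OF graph ybar])
  have C1: "1 \<le> real (card C)" using C(1) by (simp add: Suc_le_eq card_gt_0_iff)
  have \<delta>C: "real (card C) - 1 \<le> \<delta>max"
    unfolding \<delta> by (rule clique_card_le_max_eigenvalue[OF clique C(1)])
  have \<delta>0: "0 \<le> \<delta>max" using max_eigenvalue_nonneg by (simp add: \<delta>)
  have L0: "0 < L" using \<delta>0 alpha by (simp add: L)
  \<comment> \<open>The right side of the closeness assumption, written with \<open>L\<close>; one
    radius for all iterates of the induction.\<close>
  define \<rho> where "\<rho> = malpha / (malpha + real (card C) * L)"
  have \<rho>: "l1_norm (x kbar - ?c) \<le> \<rho>"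
    using close by (simp add: \<rho>_def L algebra_simps)

  \<comment> \<open>If a vertex extended \<open>C\<close>, then \<open>malpha\<close> would lie in
    (-1, 0) while an edge gives \<open>\<delta>max \<ge> 1\<close> and hence a positive denominator.
    So \<open>\<rho>\<close> would be negative, although it bounds a norm.\<close>
  have m_pos: "0 < malpha"
    using m_clique_cases[OF C(2), of ?F]
  proof
    assume "1 \<le> m_clique C ?F"
    with alpha show ?thesis by (simp add: malpha m_clique_alpha_def)
  next
    assume m0: "m_clique C ?F = 0 \<and> (\<exists>v. v \<notin> C \<and> C \<subseteq> neighbors ?F v)"
    then obtain v w where "w \<in> C" "w \<in> neighbors ?F v" using C(1) by blast
    then have "M $ v $ w = 1" by (simp add: neighbors_def M_def mem_aug_edges_iff)
    then have "1 \<le> \<delta>max" using entry_le_max_eigenvalue[of v w] by (simp add: \<delta>)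
    then have "2 \<le> L" using alpha by (simp add: L)
    then have "2 \<le> real (card C) * L" using C1 mult_mono[of 1 "real (card C)" 2 L] by simp
    moreover have "malpha < 0" "-1 < malpha"
      using m0 alpha by (auto simp: malpha m_clique_alpha_def)
    ultimately have "\<rho> < 0" by (simp add: \<rho>_def divide_less_0_iff)
    moreover have "0 \<le> l1_norm (x kbar - ?c)" by (simp add: l1_norm_def sum_nonneg)
    ultimately show ?thesis using \<rho> by simp
  qed
  obtain v where v: "v \<notin> C" using C(2) by blast
  \<comment> \<open>Together with the eigenvalue bound for cliques this gives
    \<open>malpha \<le> L / 2\<close>, which makes \<open>\<rho>\<close> small enough to keep
    \<open>C\<close> in the support.\<close>
  have "malpha \<le> real (card C) - 1 + \<alpha> / 2"
    using m_clique_le[OF v, of ?F] by (simp add: malpha m_clique_alpha_def)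
  with \<delta>C have m_le: "malpha \<le> L / 2" using \<delta>0 by (simp add: L)
  have den: "0 < malpha + real (card C) * L" using m_pos C1 L0 by (simp add: add_pos_nonneg)
  have "malpha * real (card C) \<le> (L / 2) * real (card C)"
    using m_le by (intro mult_right_mono) auto
  also have "\<dots> < 2 * (malpha + real (card C) * L)"
    using m_pos C1 L0 by (simp add: algebra_simps add_strict_increasing2 mult_pos_pos)
  finally have \<rho>C: "\<rho> < 2 / real (card C)"
    using den C1 by (simp add: \<rho>_def divide_less_eq less_divide_eq mult_ac)

  \<comment> \<open>The shift \<open>- 1 + \<alpha> / 2\<close> in \<open>malpha\<close> is chosen
    so that \<open>\<gamma> - \<Delta>\<close> equals \<open>2 * (card C - m) / card C\<close>, with
    \<open>m\<close> the clique defect.\<close>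
  define \<gamma> where "\<gamma> = (2 * (real (card C) - 1) + \<alpha>) / real (card C)"
  define \<Delta> where "\<Delta> = 2 * malpha / real (card C)"
  have \<Delta>0: "0 < \<Delta>" using m_pos C1 by (simp add: \<Delta>_def)
  have radius: "2 * L * \<epsilon> \<le> \<Delta> * (1 - \<epsilon>)" if "\<epsilon> \<le> \<rho>" for \<epsilon>
  proof -
    have "\<epsilon> * (malpha + real (card C) * L) \<le> malpha"
      using that den by (simp add: \<rho>_def le_divide_eq)
    then have "(2 * L * \<epsilon>) * real (card C) \<le> 2 * malpha * (1 - \<epsilon>)" by (simp add: algebra_simps)
    then show ?thesis using C1 by (simp add: \<Delta>_def le_divide_eq)
  qed
  have c: "?c \<in> std_simplex" using clique_center_in_std_simplex[OF C(1)] .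
  have center_in: "(2 *\<^sub>R (M *v ?c) + \<alpha> *\<^sub>R ?c) $ j = \<gamma>" if "j \<in> C" for j
    using that row_sum_clique[OF clique that]
    by (simp add: mult_clique_center clique_center_nth \<gamma>_def add_divide_distrib)
  have center_out: "(2 *\<^sub>R (M *v ?c) + \<alpha> *\<^sub>R ?c) $ j \<le> \<gamma> - \<Delta>" if "j \<notin> C" for j
  proof -
    have "(\<Sum>k\<in>C. M $ j $ k) \<le> real (card C) - m_clique C ?F"
      using m_clique_le[OF that, of ?F] by (simp add: deg)
    then have "2 * (\<Sum>k\<in>C. M $ j $ k) / real (card C)
        \<le> (2 * (real (card C) - 1) + \<alpha> - 2 * malpha) / real (card C)"
      using C1 by (intro divide_right_mono) (auto simp: malpha m_clique_alpha_def)
    with that show ?thesis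
      by (simp add: mult_clique_center clique_center_nth \<gamma>_def \<Delta>_def diff_divide_distrib)
  qed
  have grad: "gradient (\<lambda>w. h_obj E \<alpha> \<beta> (w, ybar)) u = 2 *\<^sub>R (M *v u) + \<alpha> *\<^sub>R u" for u
    using gradient_quadratic[OF transpose_eq, of \<alpha> "\<beta> / 2 * (norm ybar)\<^sup>2" u]
    by (simp add: h_obj_def M_def)
  have simplex: "x k \<in> std_simplex" for k
    by (rule fwdc_sequence_in_std_simplex[OF seq])

  \<comment> \<open>Each step removes exactly one vertex outside \<open>C\<close> and stays within
    the radius. Only steps with \<open>j < card Ic\<close> occur, where \<open>y\<close> is still
    \<open>ybar\<close>.\<close>
  have inv: "l1_norm (x (kbar + j) - ?c) \<le> \<rho> \<and> card (supp (x (kbar + j)) - C) = card Ic - j"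
    if "j \<le> card Ic" for j
    using that
  proof (induction j)
    case 0
    show ?case using \<rho> by (simp add: Ic)
  next
    case (Suc j)
    define k where "k = kbar + j"
    let ?f = "\<lambda>w. h_obj E \<alpha> \<beta> (w, ybar)"
    define \<epsilon> where "\<epsilon> = l1_norm (x k - ?c)"
    have \<epsilon>: "\<epsilon> \<le> \<rho>" and card: "card (supp (x k) - C) = card Ic - j"
      using Suc by (auto simp: k_def \<epsilon>_def)
    have yk: "y k = ybar" using y_const[of j] Suc.prems by (simp add: k_def)
    have ne: "supp (x k) - C \<noteq> {}"
      using card Suc.prems by (metis Suc_le_eq card.empty less_irrefl zero_less_diff)
    have Csub: "C \<subseteq> supp (x k)"
      using supp_superset_of_close[OF simplex C(1)] \<epsilon> \<rho>C by (simp add: \<epsilon>_def)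
    have near: "\<bar>gradient ?f (x k) $ i - (2 *\<^sub>R (M *v ?c) + \<alpha> *\<^sub>R ?c) $ i\<bar> \<le> L * \<epsilon> / 2" for i
      using gradient_lipschitz_l1[OF simplex c, of \<alpha> k i] alpha unfolding grad L \<delta> \<epsilon>_def by simp
    have inC: "\<bar>gradient ?f (x k) $ i - \<gamma>\<bar> \<le> L * \<epsilon> / 2" if "i \<in> C" for i
      using near[of i] center_in[OF that] by simp
    have outC: "gradient ?f (x k) $ i \<le> \<gamma> - \<Delta> + L * \<epsilon> / 2" if "i \<notin> C" for i
      using near[of i] center_out[OF that] by linarith
    \<comment> \<open>The centre vanishes outside \<open>C\<close>, so the mass of the iterate there
      is a partial mass of the difference.\<close>
    have "(\<Sum>i\<in>UNIV. (if i \<in> C then 0 else 1) * (x k $ i - ?c $ i)) = (\<Sum>i\<in>UNIV. if i \<in> C then 0 else x k $ i)"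
      by (rule sum.cong) (auto simp: clique_center_nth)
    moreover have "\<bar>\<Sum>i\<in>UNIV. (if i \<in> C then 0 else 1) * (x k $ i - ?c $ i)\<bar> \<le> \<epsilon> / 2"
      unfolding \<epsilon>_def by (rule partial_mass_diff_le[OF simplex c]) simp
    ultimately have mass: "(\<Sum>i\<in>-C. x k $ i) \<le> \<epsilon> / 2"
      by (simp add: sum.If_cases abs_le_iff)
    obtain i where i: "i \<in> supp (x k)" "i \<notin> C" using ne by blast
    obtain i' where i': "i' \<in> C" using C(1) by blast
    have "0 < x k $ i" using i(1) std_simplexD(1)[OF simplex, of k i] by (simp add: supp_def)
    also have "\<dots> \<le> (\<Sum>i\<in>-C. x k $ i)"
      by (rule member_le_sum) (use i(2) in \<open>auto simp: std_simplexD[OF simplex]\<close>)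
    finally have \<epsilon>0: "0 < \<epsilon>" using mass by simp
    \<comment> \<open>The errors \<open>L * \<epsilon> / 2\<close> on both sides then cannot close
      the gap, so gradient entries outside \<open>C\<close> stay below those on
      \<open>C\<close>.\<close>
    have "L * \<epsilon> < \<Delta>"
    proof -
      have "\<Delta> * (1 - \<epsilon>) < \<Delta>" using \<Delta>0 \<epsilon>0 by (simp add: right_diff_distrib)
      with radius[OF \<epsilon>] L0 \<epsilon>0 mult_pos_pos[OF L0 \<epsilon>0] show ?thesis by linarith
    qed
    then have "gradient ?f (x k) $ i < gradient ?f (x k) $ i'"
      using inC[OF i'] outC[OF i(2)] by linarith
    from not_stationary_std_simplex[OF simplex i(1) this]
    have ns: "\<not> stationary ?f std_simplex (x k)" .
    \<comment> \<open>The algorithm has not stopped, so a genuine step is taken and the stepsize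
      condition applies.\<close>
    then have nz: "\<not> stationary (h_obj E \<alpha> \<beta>) (P_set E s) (x k, y k)"
      using stationary_partial[OF h_obj_differentiable]
        D_set_subset ybar unfolding P_set_def yk by blast
    have "fdfw_step ?f std_simplex (x k) (d k) (a k) (x (Suc k))"
      using seq nz unfolding fwdc_sequence_def yk[symmetric] by metis
    then have step: "fdfw_direction ?f std_simplex (x k) (d k)"
      "a k \<le> max_step std_simplex (x k) (d k)" "x (Suc k) = x k + a k *\<^sub>R d k"
      using ns by (auto simp: fdfw_step_def)
    have size: "min (max_step std_simplex (x k) (d k))
        (1 / L * (gradient ?f (x k) \<bullet> d k / (norm (d k))\<^sup>2)) \<le> a k"
      using stepsize[of k] ns nz by (simp add: x_step_taken_def yk)
    obtain l where l: "l \<in> supp (x k) - C" "x k $ l < 1" "x (Suc k) = drop_coord l (x k)"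
      using fdfw_step_drops_vertex[OF simplex mass inC outC L0 \<Delta>0 radius[OF \<epsilon>] ne step size] .
    have "x k \<noteq> axis l 1" using l(2) by auto
    then have "l1_norm (x (Suc k) - ?c) \<le> \<epsilon>"
      unfolding l(3) \<epsilon>_def using l(1) by (intro l1_norm_drop_coord_le simplex c) (auto simp: supp_clique_center)
    moreover have "supp (x (Suc k)) - C = (supp (x k) - C) - {l}"
      using l(2) by (auto simp: l(3) supp_drop_coord)
    ultimately show ?case
      using \<epsilon> card l(1) by (simp add: k_def)
  qed
  have final: "l1_norm (x (kbar + card Ic) - ?c) \<le> \<rho>" "supp (x (kbar + card Ic)) - C = {}"
    using inv[of "card Ic"] by auto
  have "C \<subseteq> supp (x (kbar + card Ic))"
    using supp_superset_of_close[OF simplex C(1)] final(1) \<rho>C by simp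
  with final(2) show ?thesis by blast
qed

end
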